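(* For every integer $k>0$, with $n=8k+2$, we have $\mathsf{D}_{\oplus}(\mathrm{THR}_n^3)=n-1$.
   Context: $\mathrm{THR}_n^3\colon\{0,1\}^n\to\{-1,1\}$ is defined by $\mathrm{THR}_n^3(x)=-1$ iff $\sum_{i=1}^n x_i\ge 3$. A parity decision tree is a rooted binary tree whose internal nodes are labeled by parities $\bigoplus_{i\in S}x_i$, with two outgoing edges labeled by the possible parity values, and leaves labeled by $-1$ or $1$; $\mathsf{D}_{\oplus}(f)$ is the minimal depth of a parity decision tree computing $f$. *)

theory Defs
  imports Main "HOL-Library.FuncSet"
begin

definition cube :: "nat \<Rightarrow> (nat \<Rightarrow> nat) set" where
  "cube n = {1..n} \<rightarrow>\<^sub>E {0, 1}"

definition THR3 :: "nat \<Rightarrow> (nat \<Rightarrow> nat) \<Rightarrow> int" where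
  "THR3 n x = (if (\<Sum>i=1..n. x i) \<ge> 3 then -1 else 1)"

(* Query S t0 t1 queries the parity of the bits indexed by S and
   continues with t0 if it is 0 and with t1 if it is 1. *)
datatype pdt = Leaf int | Query "nat set" pdt pdt

fun pdt_on :: "nat \<Rightarrow> pdt \<Rightarrow> bool" where
  "pdt_on n (Leaf b) \<longleftrightarrow> b \<in> {-1, 1}"
| "pdt_on n (Query S t0 t1) \<longleftrightarrow> S \<subseteq> {1..n} \<and> pdt_on n t0 \<and> pdt_on n t1"

fun pdt_value :: "pdt \<Rightarrow> (nat \<Rightarrow> nat) \<Rightarrow> int" where
  "pdt_value (Leaf b) x = b"
| "pdt_value (Query S t0 t1) x =
     (if (\<Sum>i\<in>S. x i) mod 2 = 0 then pdt_value t0 x else pdt_value t1 x)"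

fun pdt_depth :: "pdt \<Rightarrow> nat" where
  "pdt_depth (Leaf b) = 0"
| "pdt_depth (Query S t0 t1) = Suc (max (pdt_depth t0) (pdt_depth t1))"

definition pdt_computes :: "nat \<Rightarrow> pdt \<Rightarrow> ((nat \<Rightarrow> nat) \<Rightarrow> int) \<Rightarrow> bool" where
  "pdt_computes n t f \<longleftrightarrow> pdt_on n t \<and> (\<forall>x\<in>cube n. pdt_value t x = f x)"

(* For f with values in {-1, 1} on the cube the set of depths is nonempty (query all bits
   one by one), so LEAST is a true minimum. *)
definition D_parity :: "nat \<Rightarrow> ((nat \<Rightarrow> nat) \<Rightarrow> int) \<Rightarrow> nat" where
  "D_parity n f = (LEAST d. \<exists>t. pdt_computes n t f \<and> pdt_depth t = d)"

end

theory Submission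
  imports Defs
begin

text \<open>
  Lower bound: let \<open>K T\<close> be the sum of the character \<open>chi T\<close> over the points of weight at most 2.
  The indicator of the inputs on which a tree of depth \<open>d\<close> outputs 1 has all its character sums
  divisible by \<open>2 ^ (n - d)\<close>. For \<open>n = 8 * k + 2\<close> every \<open>K T\<close> is a multiple of 4, so this alone only
  gives depth \<open>n - 2\<close>. But a root query \<open>S\<close> followed by trees of depth \<open>n - 3\<close> forces
  \<open>8 dvd K T + K (T \<triangle> S)\<close> for all \<open>T\<close>, and the parity of \<open>K T / 4\<close> depends on \<open>card T mod 4\<close>
  in such a way that \<open>T = {}\<close> or a singleton \<open>T\<close> violates this unless \<open>S = {}\<close>, and an empty root
  query is wasted.

  Upper bound: query the parities of the pairs of neighbouring bits. A pair of odd parity has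
  weight 1, so one bit need not be determined. If all pairs are constant, pair up the pairs in the
  same way, leaving one pair over; if again all parities are 0, the weight is at least 3 iff one of the
  blocks of four is nonzero, and the last pair is irrelevant.
\<close>

section \<open>Character sums\<close>

definition chi :: "nat set \<Rightarrow> (nat \<Rightarrow> nat) \<Rightarrow> int" where
  "chi T x = (-1) ^ (\<Sum>i\<in>T. x i)"

lemma chi_sym_diff:
  assumes "finite S" "finite T"
  shows "chi (sym_diff T S) x = chi T x * chi S x"
proof -
  have T: "(\<Sum>i\<in>T. x i) = (\<Sum>i\<in>T - S. x i) + (\<Sum>i\<in>T \<inter> S. x i)"
    using sum.Int_Diff[OF assms(2), of x S] by simp
  have S: "(\<Sum>i\<in>S. x i) = (\<Sum>i\<in>S - T. x i) + (\<Sum>i\<in>T \<inter> S. x i)"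
    using sum.Int_Diff[OF assms(1), of x T] by (simp add: Int_commute)
  have "(\<Sum>i\<in>sym_diff T S. x i) = (\<Sum>i\<in>T - S. x i) + (\<Sum>i\<in>S - T. x i)"
    using assms by (intro sum.union_disjoint) auto
  then show ?thesis
    unfolding chi_def T S by (simp add: power_add power_mult_distrib[symmetric])
qed

lemma chi_parity: "chi S x = (if (\<Sum>i\<in>S. x i) mod 2 = 0 then 1 else -1)"
  by (simp add: chi_def minus_one_power_iff even_iff_mod_2_eq_zero)

text \<open>The unnormalised Fourier coefficient at \<open>T\<close> of the indicator of the inputs
  with value 1.\<close>

definition char_sum :: "nat \<Rightarrow> ((nat \<Rightarrow> nat) \<Rightarrow> int) \<Rightarrow> nat set \<Rightarrow> int" where
  "char_sum n f T = (\<Sum>x\<in>cube n. of_bool (f x = 1) * chi T x)"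

text \<open>Flipping one bit of \<open>T\<close> is an involution of the cube that reverses the sign
  of \<open>chi T\<close>.\<close>

lemma sum_chi_cube:
  assumes "T \<subseteq> {1..n}"
  shows "(\<Sum>x\<in>cube n. chi T x) = (if T = {} then 2 ^ n else 0)"
proof (cases "T = {}")
  case True
  have "card (cube n) = 2 ^ n"
    by (simp add: cube_def card_PiE numeral_2_eq_2)
  with True show ?thesis by (simp add: chi_def)
next
  case False
  then obtain a where a: "a \<in> T" by blast
  with assms have fin: "finite T" and an: "a \<in> {1..n}"
    by (auto intro: finite_subset)
  let ?F = "\<lambda>x::nat \<Rightarrow> nat. x(a := 1 - x a)"
  have F: "?F x \<in> cube n" "?F (?F x) = x" if "x \<in> cube n" for x
  proof -
    have "x a \<in> {0, 1}" using that an by (auto simp: cube_def)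
    then have "1 - (1 - x a) = x a" by auto
    then show "?F (?F x) = x" by simp
    show "?F x \<in> cube n"
      using that an by (auto simp: cube_def PiE_iff extensional_def)
  qed
  have neg: "chi T (?F x) = - chi T x" if "x \<in> cube n" for x
  proof -
    have xa: "x a = 0 \<or> x a = 1" using that an by (auto simp: cube_def)
    have "(\<Sum>i\<in>T - {a}. ?F x i) = (\<Sum>i\<in>T - {a}. x i)"
      by (intro sum.cong) auto
    then show ?thesis
      using xa unfolding chi_def sum.remove[OF fin a] by (auto simp: power_add)
  qed
  have "(\<Sum>x\<in>cube n. chi T x) = (\<Sum>x\<in>cube n. chi T (?F x))"
    by (rule sum.reindex_bij_witness[of _ ?F ?F]) (use F in auto)
  also have "\<dots> = - (\<Sum>x\<in>cube n. chi T x)"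
    by (subst sum_negf[symmetric], rule sum.cong[OF refl neg])
  finally show ?thesis using False by simp
qed

text \<open>At a leaf the sum is 0 or a full sum of \<open>chi T\<close> over the cube; each query
  costs one factor 2. Keeping the power of the depth on the right avoids the subtraction
  \<open>n - d\<close>, and each level of the induction contributes exactly one factor.\<close>

lemma dvd_char_sum_pdt:
  assumes "pdt_on n t" "T \<subseteq> {1..n}"
  shows "2 ^ n dvd 2 ^ pdt_depth t * char_sum n (pdt_value t) T"
  using assms
proof (induction t arbitrary: T)
  case (Leaf b)
  then show ?case
    by (simp add: char_sum_def sum_chi_cube flip: sum_distrib_left)
next
  case (Query S t0 t1)
  then have S: "S \<subseteq> {1..n}" and fin: "finite S" "finite T"
    by (auto intro: finite_subset)
  let ?m = "max (pdt_depth t0) (pdt_depth t1)"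
  let ?U = "sym_diff T S"
  have U: "?U \<subseteq> {1..n}" using S Query.prems by auto
  have lift: "(2::int) ^ n dvd 2 ^ ?m * w" if "2 ^ n dvd 2 ^ d * w" "d \<le> ?m" for d w
    by (rule dvd_trans[OF that(1)]) (intro mult_dvd_mono le_imp_power_dvd that(2) dvd_refl)
  have d: "2 ^ n dvd 2 ^ ?m * char_sum n (pdt_value t0) T"
    "2 ^ n dvd 2 ^ ?m * char_sum n (pdt_value t0) ?U"
    "2 ^ n dvd 2 ^ ?m * char_sum n (pdt_value t1) T"
    "2 ^ n dvd 2 ^ ?m * char_sum n (pdt_value t1) ?U"
    by (rule lift, rule Query.IH, use Query.prems U in auto)+
  \<comment> \<open>The indicators of the two answers are (1 + \<open>chi S\<close>)/2 and (1 -
    \<open>chi S\<close>)/2, and multiplication by \<open>chi S\<close> turns \<open>chi T\<close>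
    into the character of \<open>?U\<close>.\<close>
  have "2 * char_sum n (pdt_value (Query S t0 t1)) T =
      char_sum n (pdt_value t0) T + char_sum n (pdt_value t0) ?U
      + (char_sum n (pdt_value t1) T - char_sum n (pdt_value t1) ?U)"
    unfolding char_sum_def sum_distrib_left sum.distrib[symmetric] sum_subtractf[symmetric]
    by (intro sum.cong refl) (auto simp: chi_sym_diff[OF fin] chi_parity[of S])
  then have "2 ^ pdt_depth (Query S t0 t1) * char_sum n (pdt_value (Query S t0 t1)) T =
      2 ^ ?m * (char_sum n (pdt_value t0) T + char_sum n (pdt_value t0) ?U
      + (char_sum n (pdt_value t1) T - char_sum n (pdt_value t1) ?U))"
    by (simp del: pdt_value.simps add: mult.assoc mult.left_commute)
  also have "2 ^ n dvd \<dots>"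
    unfolding distrib_left right_diff_distrib using d by (intro dvd_add dvd_diff)
  finally show ?case .
qed

lemma eight_dvd_char_sum:
  assumes "pdt_on n t" "pdt_depth t + 3 \<le> n" "T \<subseteq> {1..n}"
  shows "8 dvd char_sum n (pdt_value t) T"
proof -
  have cube: "(2::int) ^ 3 = 8" by simp
  have "n = (n - 3 - pdt_depth t) + 3 + pdt_depth t" using assms by simp
  then have "(2::int) ^ n = 2 ^ pdt_depth t * (2 ^ (n - 3 - pdt_depth t) * 8)"
    by (metis (no_types, lifting) power_add mult.commute cube)
  with dvd_char_sum_pdt[OF assms(1,3)]
  have "2 ^ (n - 3 - pdt_depth t) * 8 dvd char_sum n (pdt_value t) T"
    by simp
  then show ?thesis by (rule dvd_mult_right)
qed

section \<open>Characters of the low layers\<close>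

text \<open>The \<open>j\<close>-th elementary symmetric polynomial in the values of
  \<open>e\<close>. Exponent vectors instead of subsets make it match a character sum over the layer
  of weight \<open>j\<close>.\<close>

definition esym :: "nat set \<Rightarrow> (nat \<Rightarrow> int) \<Rightarrow> nat \<Rightarrow> int" where
  "esym I e j = (\<Sum>x\<in>I \<rightarrow>\<^sub>E {0, 1}. of_bool (sum x I = j) * (\<Prod>i\<in>I. e i ^ x i))"

lemma sum_PiE_insert:
  fixes F :: "(nat \<Rightarrow> nat) \<Rightarrow> int"
  assumes "a \<notin> I"
  shows "(\<Sum>x\<in>insert a I \<rightarrow>\<^sub>E {0, 1}. F x)
    = (\<Sum>x\<in>I \<rightarrow>\<^sub>E {0, 1}. F (x(a := 0)) + F (x(a := 1)))"
proof -
  let ?h = "\<lambda>(y, g). g(a := y)"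
  have "(\<Sum>x\<in>insert a I \<rightarrow>\<^sub>E {0, 1}. F x)
      = (\<Sum>p\<in>{0, 1} \<times> (I \<rightarrow>\<^sub>E {0, 1}). F (?h p))"
    unfolding PiE_insert_eq
    by (subst sum.reindex[OF inj_combinator[OF assms]]) (simp add: o_def)
  also have "\<dots> = (\<Sum>y\<in>{0, 1}. \<Sum>x\<in>I \<rightarrow>\<^sub>E {0, 1}. F (x(a := y)))"
    by (simp add: sum.cartesian_product split_def)
  finally show ?thesis by (simp add: sum.distrib)
qed

lemma esym_insert:
  assumes "finite I" "a \<notin> I"
  shows "esym (insert a I) e j = esym I e j + (if j = 0 then 0 else e a * esym I e (j - 1))"
proof -
  have s: "sum (x(a := y)) (insert a I) = y + sum x I" for x y
  proof -
    have "sum (x(a := y)) I = sum x I" using assms by (intro sum.cong) auto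
    then show ?thesis using assms by simp
  qed
  have p: "(\<Prod>i\<in>insert a I. e i ^ (x(a := y)) i) = e a ^ y * (\<Prod>i\<in>I. e i ^ x i)" for x y
  proof -
    have "(\<Prod>i\<in>I. e i ^ (x(a := y)) i) = (\<Prod>i\<in>I. e i ^ x i)"
      using assms by (intro prod.cong) auto
    then show ?thesis using assms by simp
  qed
  show ?thesis
    unfolding esym_def sum_PiE_insert[OF assms(2)] s p
    by (cases j) (simp_all add: sum.distrib sum_distrib_left mult_ac)
qed

text \<open>Newton's identities up to degree 2, the last one doubled to stay within the
  integers.\<close>

lemma esym_012:
  assumes "finite I"
  shows "esym I e 0 = 1" "esym I e 1 = sum e I"
    "2 * esym I e 2 = (sum e I)\<^sup>2 - (\<Sum>i\<in>I. (e i)\<^sup>2)"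
proof -
  have empty: "esym {} e j = of_bool (j = 0)" for j
    by (simp add: esym_def)
  have "esym I e 0 = 1 \<and> esym I e 1 = sum e I \<and>
    2 * esym I e 2 = (sum e I)\<^sup>2 - (\<Sum>i\<in>I. (e i)\<^sup>2)"
    using assms
    by induction (simp_all add: empty esym_insert algebra_simps power2_eq_square)
  then show "esym I e 0 = 1" "esym I e 1 = sum e I"
    "2 * esym I e 2 = (sum e I)\<^sup>2 - (\<Sum>i\<in>I. (e i)\<^sup>2)"
    by blast+
qed

text \<open>The value 1 is taken on the layers of weight 0, 1 and 2, so the sum is that of the first
  three elementary symmetric polynomials at the signs that are -1 on \<open>T\<close> and 1
  elsewhere. These signs add up to \<open>m\<close>, their squares to \<open>n\<close>.\<close>

lemma char_sum_THR3:
  assumes "T \<subseteq> {1..n}" "m = int n - 2 * int (card T)"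
  shows "2 * char_sum n (THR3 n) T = 2 + 2 * m + m\<^sup>2 - int n"
proof -
  define e :: "nat \<Rightarrow> int" where "e i = (if i \<in> T then -1 else 1)" for i
  have fin: "finite T" using assms(1) by (rule finite_subset) simp
  have chi: "chi T x = (\<Prod>i\<in>{1..n}. e i ^ x i)" for x
  proof -
    have "(\<Prod>i\<in>{1..n}. e i ^ x i) = (\<Prod>i\<in>T. e i ^ x i)"
      using assms(1) by (intro prod.mono_neutral_right) (auto simp: e_def)
    also have "\<dots> = (\<Prod>i\<in>T. (-1) ^ x i)" by (simp add: e_def)
    also have "\<dots> = chi T x" by (simp add: chi_def power_sum)
    finally show ?thesis ..
  qed
  have "char_sum n (THR3 n) T = esym {1..n} e 0 + esym {1..n} e 1 + esym {1..n} e 2"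
    unfolding char_sum_def esym_def cube_def chi sum.distrib[symmetric] distrib_right[symmetric]
  proof (intro sum.cong refl arg_cong2[where f = "(*)"])
    show "of_bool (THR3 n x = 1) = (of_bool (sum x {1..n} = 0) + of_bool (sum x {1..n} = 1)
        + of_bool (sum x {1..n} = 2) :: int)" for x
      unfolding THR3_def by (cases "sum x {1..n}" rule: nat.exhaust) (simp_all del: sum_eq_0_iff)
  qed
  moreover have "sum e {1..n} = m"
  proof -
    have "sum e {1..n} = sum e ({1..n} - T) + sum e T"
      using assms(1) by (intro sum.subset_diff) auto
    also have "\<dots> = int (card ({1..n} - T)) - int (card T)"
      by (simp add: e_def)
    also have "int (card ({1..n} - T)) = int n - int (card T)"
      using assms(1) fin card_mono[OF _ assms(1)] by (simp add: card_Diff_subset of_nat_diff)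
    finally show ?thesis using assms(2) by simp
  qed
  moreover have "(\<Sum>i\<in>{1..n}. (e i)\<^sup>2) = int n"
  proof -
    have "(e i)\<^sup>2 = 1" for i by (simp add: e_def)
    then show ?thesis by simp
  qed
  ultimately show ?thesis
    using esym_012[of "{1..n}" e] by simp
qed

text \<open>Isolates the dependence on \<open>T\<close> modulo 8. The term with \<open>k\<close> is
  the same for all \<open>T\<close>, so modulo 8 it vanishes from a sum of two such values.\<close>

lemma char_sum_THR3_mod_8:
  assumes "T \<subseteq> {1..n}" "n = 8 * k + 2" "s = int (card T)"
  shows "\<exists>c. char_sum n (THR3 n) T = 2 * ((s - 1) * (s - 2)) - 4 * int k + 8 * c"
proof -
  define u where "u = int k"
  have "2 * char_sum n (THR3 n) T
      = 2 + 2 * (int n - 2 * s) + (int n - 2 * s)\<^sup>2 - int n"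
    using char_sum_THR3[OF assms(1) refl] assms(3) by simp
  moreover have "int n = 8 * u + 2" using assms(2) by (simp add: u_def)
  ultimately have "char_sum n (THR3 n) T
      = 2 * ((s - 1) * (s - 2)) - 4 * u + 8 * (u * (4 * u + 3 - 2 * s))"
    by (simp add: algebra_simps power2_eq_square)
  then show ?thesis unfolding u_def by blast
qed

section \<open>The lower bound\<close>

lemma char_sum_pdt_computes:
  assumes "pdt_computes n t f"
  shows "char_sum n (pdt_value t) T = char_sum n f T"
  using assms unfolding pdt_computes_def char_sum_def by (intro sum.cong) auto

text \<open>The sums at the empty set and at a singleton are 4 - 4k and -4k modulo 8, so they cannot
  both be multiples of 8.\<close>

lemma depth_THR3_gt_n_minus_3:
  assumes "pdt_computes n t (THR3 n)" "n = 8 * k + 2"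
  shows "\<not> pdt_depth t + 3 \<le> n"
proof
  assume *: "pdt_depth t + 3 \<le> n"
  have on: "pdt_on n t" using assms(1) by (simp add: pdt_computes_def)
  have sub: "{} \<subseteq> {1..n}" "{1} \<subseteq> {1..n}" using assms(2) by auto
  have "8 dvd char_sum n (THR3 n) {}" "8 dvd char_sum n (THR3 n) {1}"
    using eight_dvd_char_sum[OF on * sub(1)] eight_dvd_char_sum[OF on * sub(2)]
    by (simp_all add: char_sum_pdt_computes[OF assms(1)])
  with char_sum_THR3_mod_8[OF sub(1) assms(2) refl] char_sum_THR3_mod_8[OF sub(2) assms(2) refl]
  show False by auto presburger
qed

text \<open>The sum of the two characters is \<open>chi T\<close> times (1 + \<open>chi S\<close>).
  It vanishes where \<open>S\<close> has odd parity, and on all other inputs \<open>f\<close> agrees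
  with \<open>t0\<close>, so the divisibility for \<open>t0\<close> carries over.\<close>

lemma dvd_char_sum_query:
  assumes "pdt_computes n (Query S t0 t1) f" "pdt_depth t0 + 3 \<le> n" "T \<subseteq> {1..n}"
  shows "8 dvd char_sum n f T + char_sum n f (sym_diff T S)"
proof -
  have on: "pdt_on n t0" and S: "S \<subseteq> {1..n}"
    using assms(1) by (simp_all add: pdt_computes_def)
  have fin: "finite S" "finite T" using S assms(3) by (auto intro: finite_subset)
  have U: "sym_diff T S \<subseteq> {1..n}" using S assms(3) by auto
  have val: "pdt_value t0 x = f x" if "x \<in> cube n" "(\<Sum>i\<in>S. x i) mod 2 = 0" for x
    using assms(1) that unfolding pdt_computes_def by force
  have "char_sum n f T + char_sum n f (sym_diff T S)
      = char_sum n (pdt_value t0) T + char_sum n (pdt_value t0) (sym_diff T S)"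
    unfolding char_sum_def sum.distrib[symmetric]
    by (intro sum.cong refl) (auto simp: chi_sym_diff[OF fin] chi_parity[of S] val)
  also have "8 dvd \<dots>"
    using eight_dvd_char_sum[OF on assms(2)] assms(3) U by (intro dvd_add) auto
  finally show ?thesis .
qed

lemma depth_THR3_ge:
  assumes "pdt_computes n t (THR3 n)" "n = 8 * k + 2" "k > 0"
  shows "n - 1 \<le> pdt_depth t"
proof (rule ccontr)
  assume small: "\<not> n - 1 \<le> pdt_depth t"
  show False
  proof (cases t)
    case (Leaf b)
    \<comment> \<open>As \<open>k > 0\<close>, a leaf has depth at most \<open>n - 3\<close>. For
      \<open>k = 0\<close> the function is constant and a leaf would do.\<close>
    with depth_THR3_gt_n_minus_3[OF assms(1,2)] assms(2,3) show False by simp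
  next
    case (Query S t0 t1)
    have S: "S \<subseteq> {1..n}" and d0: "pdt_depth t0 + 3 \<le> n"
      using assms(1) small Query by (auto simp: pdt_computes_def)
    have fin: "finite S" using S by (rule finite_subset) simp
    have "S \<noteq> {}"
    proof
      assume "S = {}"
      then have "pdt_computes n t0 (THR3 n)"
        using assms(1) Query by (simp add: pdt_computes_def)
      with depth_THR3_gt_n_minus_3 assms(2) d0 show False by blast
    qed
    define g where "g s = (s - 1) * (s - 2)" for s :: int
    have key: "4 dvd g (int (card T)) + g (int (card (sym_diff T S)))"
      if T: "T \<subseteq> {1..n}" for T
    proof -
      have U: "sym_diff T S \<subseteq> {1..n}" using T S by auto
      obtain c c' where
        "char_sum n (THR3 n) T = 2 * g (int (card T)) - 4 * int k + 8 * c"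
        "char_sum n (THR3 n) (sym_diff T S) = 2 * g (int (card (sym_diff T S))) - 4 * int k + 8 * c'"
        using char_sum_THR3_mod_8[OF T assms(2) refl] char_sum_THR3_mod_8[OF U assms(2) refl]
        unfolding g_def by blast
      with dvd_char_sum_query[OF assms(1)[unfolded Query] d0 T]
      show ?thesis by presburger
    qed
    \<comment> \<open>\<open>g\<close> is periodic modulo 4, with residues 2, 0, 0, 2 at 0, 1, 2, 3.
      As only 0 and 2 occur, 4 divides a sum of two values iff their residues agree.\<close>
    have g_mod: "g (int c) mod 4 = (if c mod 4 \<in> {0, 3} then 2 else 0)" for c
    proof -
      define q r where "q = int c div 4" and "r = int (c mod 4)"
      have "int c = 4 * q + r" by (simp add: q_def r_def zmod_int)
      then have "g (int c) = g r + 4 * (4 * q * q + 2 * q * r - 3 * q)"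
        by (simp add: g_def algebra_simps)
      then have "g (int c) mod 4 = g r mod 4" by (simp only: mod_mult_self2)
      moreover have "c mod 4 < 4" by simp
      then have "c mod 4 = 0 \<or> c mod 4 = 1 \<or> c mod 4 = 2 \<or> c mod 4 = 3" by linarith
      then have "g r mod 4 = (if c mod 4 \<in> {0, 3} then 2 else 0)"
        unfolding r_def by (elim disjE) (simp_all add: g_def)
      ultimately show ?thesis by simp
    qed
    have same: "card T mod 4 \<in> {0, 3} \<longleftrightarrow> card (sym_diff T S) mod 4 \<in> {0, 3}"
      if T: "T \<subseteq> {1..n}" for T
    proof -
      have "(g (int (card T)) mod 4 + g (int (card (sym_diff T S))) mod 4) mod 4 = 0"
        using key[OF T] by (simp only: mod_add_eq mod_eq_0_iff_dvd)
      then show ?thesis unfolding g_mod by (simp only: split: if_splits) simp_all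
    qed
    have S03: "card S mod 4 = 0 \<or> card S mod 4 = 3" using same[of "{}"] by simp
    \<comment> \<open>A singleton inside \<open>S\<close> has size 1, outside the class {0, 3}. If
      \<open>card S\<close> were 0 modulo 4, removing a point would lead to 3, inside that
      class.\<close>
    have S3: "card S mod 4 = 3"
    proof -
      obtain a where a: "a \<in> S" using \<open>S \<noteq> {}\<close> by blast
      then have "sym_diff {a} S = S - {a}" by auto
      moreover have "{a} \<subseteq> {1..n}" using a S by auto
      ultimately have "card (S - {a}) mod 4 \<noteq> 3" using same[of "{a}"] by simp
      moreover have "card S = card (S - {a}) + 1" using card_Suc_Diff1[OF fin a] by simp
      ultimately show ?thesis using S03 by presburger
    qed
    \<comment> \<open>Since \<open>n\<close> is 2 modulo 4, a point \<open>b\<close> outside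
      \<open>S\<close> exists. Adding it to \<open>S\<close> gives a size that is 0 modulo 4, while
      the singleton of \<open>b\<close> has size 1.\<close>
    have "S \<noteq> {1..n}"
    proof
      assume "S = {1..n}"
      then have "card S = 8 * k + 2" using assms(2) by simp
      with S3 show False by presburger
    qed
    then obtain b where b: "b \<in> {1..n}" "b \<notin> S" using S by blast
    then have "sym_diff {b} S = insert b S" by auto
    moreover have "{b} \<subseteq> {1..n}" using b by simp
    ultimately have "card (insert b S) mod 4 \<noteq> 0" using same[of "{b}"] by simp
    moreover have "card (insert b S) = card S + 1" using b fin by simp
    ultimately show False using S3 by presburger
  qed
qed

section \<open>The upper bound\<close>

text \<open>A promise version: the tree must be right only on \<open>X\<close>, the inputs
  consistent with the answers so far. A bound on the depth, in place of equality, lets branches of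
  different depth be joined.\<close>

definition solvable :: "nat \<Rightarrow> ((nat \<Rightarrow> nat) \<Rightarrow> int) \<Rightarrow> (nat \<Rightarrow> nat) set \<Rightarrow> nat \<Rightarrow> bool" where
  "solvable n f X d \<longleftrightarrow> (\<exists>t. pdt_on n t \<and> pdt_depth t \<le> d \<and> (\<forall>x\<in>X. pdt_value t x = f x))"

definition par :: "nat set \<Rightarrow> (nat \<Rightarrow> nat) \<Rightarrow> nat" where
  "par S x = (\<Sum>i\<in>S. x i) mod 2"

lemma solvable_query:
  assumes "solvable n f {x \<in> X. par S x = 0} d" "solvable n f {x \<in> X. par S x = 1} d"
    and "S \<subseteq> {1..n}"
  shows "solvable n f X (Suc d)"
proof -
  obtain t0 t1 where
    "pdt_on n t0" "pdt_depth t0 \<le> d" "\<forall>x\<in>{x \<in> X. par S x = 0}. pdt_value t0 x = f x"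
    "pdt_on n t1" "pdt_depth t1 \<le> d" "\<forall>x\<in>{x \<in> X. par S x = 1}. pdt_value t1 x = f x"
    using assms unfolding solvable_def by blast
  with assms(3) show ?thesis
    unfolding solvable_def by (intro exI[of _ "Query S t0 t1"]) (auto simp: par_def)
qed

text \<open>All parities in \<open>Q\<close> are queried in turn whatever the answers are;
  \<open>f\<close> is constant on each class of inputs with equal answers.\<close>

lemma solvable_determined:
  assumes "finite Q" "card Q \<le> d" "\<forall>S\<in>Q. S \<subseteq> {1..n}" "f ` X \<subseteq> {-1, 1}"
    and "\<And>x y. x \<in> X \<Longrightarrow> y \<in> X \<Longrightarrow> (\<forall>S\<in>Q. par S x = par S y) \<Longrightarrow> f x = f y"
  shows "solvable n f X d"
  using assms
proof (induction Q arbitrary: X d)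
  case empty
  show ?case
  proof (cases "X = {}")
    case True
    \<comment> \<open>No input arrives here, so the label is arbitrary.\<close>
    then show ?thesis unfolding solvable_def by (intro exI[of _ "Leaf 1"]) simp
  next
    case False
    then obtain x where x: "x \<in> X" by blast
    then have "f x \<in> {-1, 1}" using empty.prems(3) by blast
    moreover have "\<forall>y\<in>X. f x = f y" using empty.prems(4)[OF x] by blast
    ultimately show ?thesis
      unfolding solvable_def by (intro exI[of _ "Leaf (f x)"]) simp
  qed
next
  case (insert S Q)
  from insert.hyps insert.prems(1) obtain d' where d: "d = Suc d'" "card Q \<le> d'"
    by (cases d) auto
  have "solvable n f {x \<in> X. par S x = v} d'" for v
  proof (rule insert.IH)
    show "f x = f y" if "x \<in> {x \<in> X. par S x = v}" "y \<in> {x \<in> X. par S x = v}"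
      "\<forall>S\<in>Q. par S x = par S y" for x y
      using that by (intro insert.prems(4)) auto
    show "f ` {x \<in> X. par S x = v} \<subseteq> {-1, 1}" using insert.prems(3) by blast
  qed (use insert.prems(2) d(2) in auto)
  then show ?case
    unfolding d using insert.prems(2) by (intro solvable_query) auto
qed

text \<open>The \<open>q i\<close> are queried in order until a parity is 1. Leaving at
  \<open>i\<close> has used \<open>i + 1\<close> of the \<open>d + m\<close> queries; running
  through leaves \<open>d\<close>. The induction peels off the last query, which raises
  \<open>d\<close> by one.\<close>

lemma solvable_chain:
  assumes "\<And>i. i < m \<Longrightarrow> q i \<subseteq> {1..n}"
    and "\<And>i. i < m \<Longrightarrow> solvable n f {x \<in> X. (\<forall>j<i. par (q j) x = 0) \<and> par (q i) x = 1} (d + m - Suc i)"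
    and "solvable n f {x \<in> X. \<forall>j<m. par (q j) x = 0} d"
  shows "solvable n f X (d + m)"
  using assms
proof (induction m arbitrary: d)
  case 0
  then show ?case by simp
next
  case (Suc m)
  let ?Y = "{x \<in> X. \<forall>j<m. par (q j) x = 0}"
  have "{x \<in> ?Y. par (q m) x = 0} = {x \<in> X. \<forall>j<Suc m. par (q j) x = 0}"
    by (auto simp: less_Suc_eq)
  moreover have "{x \<in> ?Y. par (q m) x = 1}
      = {x \<in> X. (\<forall>j<m. par (q j) x = 0) \<and> par (q m) x = 1}" by auto
  ultimately have "solvable n f ?Y (Suc d)"
    using Suc.prems(1)[of m] Suc.prems(2)[of m] Suc.prems(3) by (intro solvable_query[of n f _ "q m"]) simp_all
  then have "solvable n f X (Suc d + m)"
    using Suc.prems(1) Suc.prems(2) by (intro Suc.IH) simp_all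
  then show ?case by simp
qed

section \<open>Parities of single bits and pairs, and blocks of known weight\<close>

lemma cube_bit: "x \<in> cube n \<Longrightarrow> i \<in> {1..n} \<Longrightarrow> x i = 0 \<or> x i = 1"
  by (auto simp: cube_def)

lemma par_singleton: "x \<in> cube n \<Longrightarrow> i \<in> {1..n} \<Longrightarrow> par {i} x = x i"
  using cube_bit[of x n i] by (auto simp: par_def)

lemma par_singleton_eqD:
  assumes "par {i} x = par {i} y" "x \<in> cube n" "y \<in> cube n" "i \<in> {1..n}"
  shows "x i = y i"
  using assms by (simp only: par_singleton)

lemma par_pair_0:
  assumes "x \<in> cube n" "i \<in> {1..n}" "j \<in> {1..n}" "i \<noteq> j"
  shows "par {i, j} x = 0 \<longleftrightarrow> x i = x j"
  using cube_bit[OF assms(1,2)] cube_bit[OF assms(1,3)] assms(4) by (auto simp: par_def)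

lemma par_pair_1:
  assumes "x \<in> cube n" "i \<in> {1..n}" "j \<in> {1..n}" "i \<noteq> j"
  shows "par {i, j} x = 1 \<longleftrightarrow> x i + x j = 1"
  using cube_bit[OF assms(1,2)] cube_bit[OF assms(1,3)] assms(4) by (auto simp: par_def)

text \<open>Only the total weight matters, so the bits of a block \<open>B\<close> of known weight
  need not be determined one by one.\<close>

lemma THR3_eqI:
  assumes "B \<subseteq> {1..n}" "\<And>i. i \<in> {1..n} - B \<Longrightarrow> x i = y i" "sum x B = sum y B"
  shows "THR3 n x = THR3 n y"
proof -
  have "sum x {1..n} = sum x ({1..n} - B) + sum x B" for x :: "nat \<Rightarrow> nat"
    using assms(1) by (intro sum.subset_diff) auto
  moreover have "sum x ({1..n} - B) = sum y ({1..n} - B)"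
    using assms(2) by (intro sum.cong) auto
  ultimately show ?thesis using assms(3) by (simp add: THR3_def)
qed

lemma THR3_values: "THR3 n ` X \<subseteq> {-1, 1}"
  by (auto simp: THR3_def)

text \<open>The budget is \<open>4 * k + 1\<close> parities of pairs, \<open>2 * k\<close>
  comparisons of neighbouring pairs and \<open>2 * k\<close> single bits, one per block of four. An
  exit at a parity 1 saves the query that would resolve the unequal bits or pairs.\<close>

lemma ex_pdt_THR3:
  assumes n: "n = 8 * k + 2"
  shows "solvable n (THR3 n) (cube n) (n - 1)"
proof -
  define X where "X = {x \<in> cube n. \<forall>i<4 * k + 1. par {2*i+1, 2*i+2} x = 0}"
  define Y where "Y = {x \<in> X. \<forall>j<2 * k. par {4*j+1, 4*j+3} x = 0}"
  have X_pair: "x (2*i+1) = x (2*i+2)" if "x \<in> X" "i < 4 * k + 1" for x i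
    using that par_pair_0[of x n "2*i+1" "2*i+2"] n by (auto simp: X_def)
  have X_quad: "x (4*l+1) = x (4*l+2)" "x (4*l+3) = x (4*l+4)" if "x \<in> X" "l < 2 * k" for x l
  proof -
    have "2*(2*l)+1 = 4*l+1" "2*(2*l)+2 = 4*l+2" "2*(2*l+1)+1 = 4*l+3" "2*(2*l+1)+2 = 4*l+4"
      and "2*l < 4*k+1" "2*l+1 < 4*k+1" using that by simp_all
    then show "x (4*l+1) = x (4*l+2)" "x (4*l+3) = x (4*l+4)"
      using X_pair[OF that(1)] by metis+
  qed
  have X_cube: "x \<in> cube n" if "x \<in> X" for x using that by (simp add: X_def)
  have Y: "solvable n (THR3 n) Y (2 * k)"
  proof (rule solvable_determined)
    let ?Q = "(\<lambda>l. {4*l+1}) ` {..<2 * k}"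
    show "card ?Q \<le> 2 * k" using card_image_le[of "{..<2 * k}"] by simp
    \<comment> \<open>On \<open>Y\<close> each block of four is constant. A nonzero block has weight
      4; if all blocks vanish, only the last pair remains, of weight at most 2.\<close>
    have iff: "THR3 n x = -1 \<longleftrightarrow> (\<exists>l<2*k. x (4*l+1) = 1)" if x: "x \<in> Y" for x
    proof -
      have xX: "x \<in> X" using x by (simp add: Y_def)
      have eq: "x (4*l+2) = x (4*l+1)" "x (4*l+3) = x (4*l+1)" "x (4*l+4) = x (4*l+1)"
        if l: "l < 2 * k" for l
      proof -
        show "x (4*l+2) = x (4*l+1)" using X_quad[OF xX l] by simp
        show e: "x (4*l+3) = x (4*l+1)"
          using x l par_pair_0[OF X_cube[OF xX], of "4*l+1" "4*l+3"] n by (auto simp: Y_def)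
        show "x (4*l+4) = x (4*l+1)" using X_quad[OF xX l] e by simp
      qed
      show ?thesis
      proof (cases "\<exists>l<2*k. x (4*l+1) = 1")
        case True
        then obtain l where l: "l < 2 * k" "x (4*l+1) = 1" by blast
        have "sum x {4*l+1, 4*l+2, 4*l+3, 4*l+4} \<le> sum x {1..n}"
          using l n by (intro sum_mono2) auto
        moreover have "sum x {4*l+1, 4*l+2, 4*l+3, 4*l+4} = 4"
          using l eq[OF l(1)] by simp
        ultimately show ?thesis using True by (simp add: THR3_def)
      next
        case False
        have "x i = 0" if i: "i \<in> {1..n} - {8*k+1, 8*k+2}" for i
        proof -
          \<comment> \<open>Bits are numbered from 1 and blocks from 0.\<close>
          define l where "l = (i - 1) div 4"
          have l: "l < 2 * k" using i n unfolding l_def by auto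
          have "i = 4*l+1 \<or> i = 4*l+2 \<or> i = 4*l+3 \<or> i = 4*l+4"
          proof -
            have "i - 1 = 4 * l + (i - 1) mod 4" "(i - 1) mod 4 < 4" "1 \<le> i"
              using i by (simp_all add: l_def)
            then show ?thesis by linarith
          qed
          moreover have "x (4*l+1) = 0"
            using False l cube_bit[OF X_cube[OF xX], of "4*l+1"] n by auto
          ultimately show ?thesis using eq[OF l] by auto
        qed
        then have "sum x {1..n} = sum x {8*k+1, 8*k+2}"
          using n by (intro sum.mono_neutral_right) auto
        also have "\<dots> \<le> 2"
          using cube_bit[OF X_cube[OF xX], of "8*k+1"] cube_bit[OF X_cube[OF xX], of "8*k+2"] n
          by auto
        finally show ?thesis using False by (simp add: THR3_def)
      qed
    qed
    show "THR3 n x = THR3 n y" if "x \<in> Y" "y \<in> Y" "\<forall>S\<in>?Q. par S x = par S y" for x y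
    proof -
      have "x (4*l+1) = y (4*l+1)" if "l < 2 * k" for l
      proof -
        have "par {4*l+1} x = par {4*l+1} y" using \<open>\<forall>S\<in>?Q. _ S\<close> that by blast
        then show ?thesis
          by (rule par_singleton_eqD[of _ _ _ n])
            (use \<open>x \<in> Y\<close> \<open>y \<in> Y\<close> that n X_cube in \<open>auto simp: Y_def\<close>)
      qed
      then have "THR3 n x = -1 \<longleftrightarrow> THR3 n y = -1" using iff that by auto
      then show ?thesis by (auto simp: THR3_def split: if_splits)
    qed
  qed (use n THR3_values in auto)
  have X: "solvable n (THR3 n) X (2 * k + 2 * k)"
  proof (rule solvable_chain[where q = "\<lambda>j. {4*j+1, 4*j+3}"])
    show "solvable n (THR3 n) {x \<in> X. \<forall>j<2*k. par {4*j+1, 4*j+3} x = 0} (2 * k)"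
      using Y by (simp add: Y_def)
    fix j assume j: "j < 2 * k"
    show "{4*j+1, 4*j+3} \<subseteq> {1..n}" using j n by auto
    let ?Z = "{x \<in> X. (\<forall>l<j. par {4*l+1, 4*l+3} x = 0) \<and> par {4*j+1, 4*j+3} x = 1}"
    \<comment> \<open>One bit for each earlier block, which is constant, and one for each pair after
      block \<open>j\<close>, the last pair included: \<open>4 * k - j - 1\<close> queries, exactly
      the budget.\<close>
    let ?Q = "(\<lambda>l. {4*l+1}) ` {..<j} \<union> (\<lambda>l. {2*l+1}) ` {2*j+2..<4*k+1}"
    show "solvable n (THR3 n) ?Z (2 * k + 2 * k - Suc j)"
    proof (rule solvable_determined)
      have "card ?Q \<le> card ((\<lambda>l. {4*l+1}) ` {..<j}) + card ((\<lambda>l. {2*l+1}) ` {2*j+2..<4*k+1})"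
        by (rule card_Un_le)
      also have "\<dots> \<le> j + (4*k+1 - (2*j+2))"
        using card_image_le[of "{..<j}" "\<lambda>l. {4*l+1}"]
          card_image_le[of "{2*j+2..<4*k+1}" "\<lambda>l. {2*l+1}"] by simp
      finally show "card ?Q \<le> 2 * k + 2 * k - Suc j" using j by simp
      show "\<forall>S\<in>?Q. S \<subseteq> {1..n}" using j n by auto
      fix x y assume xy: "x \<in> ?Z" "y \<in> ?Z" and par: "\<forall>S\<in>?Q. par S x = par S y"
      have sX: "x \<in> X" "y \<in> X" using xy by auto
      show "THR3 n x = THR3 n y"
      proof (rule THR3_eqI)
        let ?B = "{4*j+1, 4*j+2, 4*j+3, 4*j+4}"
        show "?B \<subseteq> {1..n}" using j n by auto
        \<comment> \<open>The two pairs of block \<open>j\<close> are constant but unequal, so one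
          is 11 and the other 00.\<close>
        have B: "sum z ?B = 2" if z: "z \<in> ?Z" for z
        proof -
          have zX: "z \<in> X" using z by auto
          have "z (4*j+1) + z (4*j+3) = 1"
            using z par_pair_1[OF X_cube[OF zX], of "4*j+1" "4*j+3"] j n by auto
          moreover have "z (4*j+1) = z (4*j+2)" by (rule X_quad[OF zX j])
          moreover have "z (4*j+3) = z (4*j+4)" by (rule X_quad[OF zX j])
          ultimately show ?thesis by simp
        qed
        show "sum x ?B = sum y ?B" by (simp only: B[OF xy(1)] B[OF xy(2)])
        have odd: "x (2*l+1) = y (2*l+1)" if l: "l < 4*k+1" "l \<noteq> 2*j" "l \<noteq> 2*j+1" for l
        proof (cases "l < 2 * j")
          case False
          then have "par {2*l+1} x = par {2*l+1} y" using par l by auto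
          then show ?thesis
            by (rule par_singleton_eqD[OF _ X_cube[OF sX(1)] X_cube[OF sX(2)]]) (use l n in simp)
        next
          case True
          \<comment> \<open>The block of pair \<open>l\<close>: its first bit is queried, and its
            two pairs agree.\<close>
          define p where "p = l div 2"
          have p: "p < j" "2*l+1 = 4*p+1 \<or> 2*l+1 = 4*p+3"
          proof -
            have "l = 2 * p \<or> l = 2 * p + 1" unfolding p_def by linarith
            with True show "p < j" "2*l+1 = 4*p+1 \<or> 2*l+1 = 4*p+3" by auto
          qed
          have "par {4*p+1} x = par {4*p+1} y" using par p by auto
          then have eq: "x (4*p+1) = y (4*p+1)"
            by (rule par_singleton_eqD[OF _ X_cube[OF sX(1)] X_cube[OF sX(2)]]) (use p j n in simp)
          have pair: "z (4*p+1) = z (4*p+3)" if "z \<in> ?Z" for z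
            using that p j n par_pair_0[OF X_cube, of z "4*p+1" "4*p+3"] by auto
          have "x (4*p+3) = y (4*p+3)" using eq pair[OF xy(1)] pair[OF xy(2)] by argo
          then show ?thesis using p(2) eq by (elim disjE) (simp_all only:)
        qed
        fix i assume i: "i \<in> {1..n} - ?B"
        define l where "l = (i - 1) div 2"
        have l: "l < 4*k+1" "i = 2*l+1 \<or> i = 2*l+2" using i n unfolding l_def by auto
        have "l \<noteq> 2*j" "l \<noteq> 2*j+1" using l i by auto
        then have eq: "x (2*l+1) = y (2*l+1)" using odd l by blast
        have "x (2*l+2) = y (2*l+2)"
          using eq X_pair[OF sX(1) l(1)] X_pair[OF sX(2) l(1)] by argo
        then show "x i = y i" using l(2) eq by (elim disjE) (simp_all only:)
      qed
    qed (use THR3_values in auto)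
  qed
  have "solvable n (THR3 n) (cube n) (4 * k + (4 * k + 1))"
  proof (rule solvable_chain[where q = "\<lambda>j. {2*j+1, 2*j+2}"])
    show "solvable n (THR3 n) {x \<in> cube n. \<forall>j<4*k+1. par {2*j+1, 2*j+2} x = 0} (4 * k)"
      using X by (simp add: X_def)
    fix j assume j: "j < 4 * k + 1"
    show "{2*j+1, 2*j+2} \<subseteq> {1..n}" using j n by auto
    let ?Z = "{x \<in> cube n. (\<forall>l<j. par {2*l+1, 2*l+2} x = 0) \<and> par {2*j+1, 2*j+2} x = 1}"
    \<comment> \<open>One bit for each earlier pair, which is constant, and every bit after pair
      \<open>j\<close>: \<open>8 * k - j\<close> queries, exactly the budget. Pair \<open>j\<close>
      has weight 1 and is left alone.\<close>
    let ?Q = "(\<lambda>l. {2*l+1}) ` {..<j} \<union> (\<lambda>l. {l}) ` {2*j+3..n}"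
    show "solvable n (THR3 n) ?Z (4 * k + (4 * k + 1) - Suc j)"
    proof (rule solvable_determined)
      have "card ?Q \<le> card ((\<lambda>l. {2*l+1}) ` {..<j}) + card ((\<lambda>l. {l}) ` {2*j+3..n})"
        by (rule card_Un_le)
      also have "\<dots> \<le> j + (Suc n - (2*j+3))"
        using card_image_le[of "{..<j}" "\<lambda>l. {2*l+1}"]
          card_image_le[of "{2*j+3..n}" "\<lambda>l. {l}"] by simp
      finally show "card ?Q \<le> 4 * k + (4 * k + 1) - Suc j" using j n by simp
      show "\<forall>S\<in>?Q. S \<subseteq> {1..n}" using j n by auto
      fix x y assume xy: "x \<in> ?Z" "y \<in> ?Z" and par: "\<forall>S\<in>?Q. par S x = par S y"
      show "THR3 n x = THR3 n y"
      proof (rule THR3_eqI)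
        let ?B = "{2*j+1, 2*j+2}"
        show "?B \<subseteq> {1..n}" using j n by auto
        have B: "sum z ?B = 1" if z: "z \<in> ?Z" for z
          using z par_pair_1[of z n "2*j+1" "2*j+2"] j n by auto
        show "sum x ?B = sum y ?B" by (simp only: B[OF xy(1)] B[OF xy(2)])
        fix i assume i: "i \<in> {1..n} - ?B"
        show "x i = y i"
        proof (cases "i \<le> 2 * j")
          case False
          then have "par {i} x = par {i} y" using par i by auto
          then show ?thesis by (rule par_singleton_eqD[of _ _ _ n]) (use i xy in auto)
        next
          case True
          define l where "l = (i - 1) div 2"
          have l: "l < j" "i = 2*l+1 \<or> i = 2*l+2" using i True unfolding l_def by auto
          have "par {2*l+1} x = par {2*l+1} y" using par l by auto
          then have eq: "x (2*l+1) = y (2*l+1)"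
            by (rule par_singleton_eqD[of _ _ _ n]) (use l j n xy in auto)
          have pair: "z (2*l+1) = z (2*l+2)" if "z \<in> ?Z" for z
            using that l j n par_pair_0[of z n "2*l+1" "2*l+2"] by auto
          have "x (2*l+2) = y (2*l+2)" using eq pair[OF xy(1)] pair[OF xy(2)] by argo
          then show ?thesis using l(2) eq by (elim disjE) (simp_all only:)
        qed
      qed
    qed (use THR3_values in auto)
  qed
  then show ?thesis using n by simp
qed

theorem theorem17:
  fixes k n :: nat
  assumes "k > 0" and "n = 8 * k + 2"
  shows "D_parity n (THR3 n) = n - 1"
  unfolding D_parity_def
proof (rule Least_equality)
  obtain t where t: "pdt_computes n t (THR3 n)" "pdt_depth t \<le> n - 1"
    using ex_pdt_THR3[OF assms(2)] unfolding solvable_def pdt_computes_def by blast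
  with depth_THR3_ge[OF t(1) assms(2,1)]
  show "\<exists>t. pdt_computes n t (THR3 n) \<and> pdt_depth t = n - 1" by auto
  show "n - 1 \<le> d" if "\<exists>t. pdt_computes n t (THR3 n) \<and> pdt_depth t = d" for d
    using that depth_THR3_ge[OF _ assms(2,1)] by blast
qed

end
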